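(* Let $k$ be an infinite field, $H$ be a numerical semigroup minimally generated by the positive integers $h_1<h_2<\cdots<h_\ell$, $P$ be the polynomial ring $k[x_1,\dots,x_\ell]$, graded by $\deg x_i=h_i$, and $\mathfrak p\subset P$ be the prime ideal which defines the monomial curve $$\{(\tau^{h_1},\dots,\tau^{h_\ell})\in\mathbb A^\ell_k\mid\tau\in k\}.$$ Then the maximal generator degree of the second symbolic power of $\mathfrak p$ satisfies $$b_0(\mathfrak p^{(2)})\le\sup\{\,b_0(\mathfrak p)+h_\ell+F(H),\ 2b_0(\mathfrak p)\,\},$$ where $h_\ell$ is the maximal generator of $H$ and $F(H)$ is the Frobenius number of $H$.
   Context: A numerical semigroup is a submonoid of $(\mathbb Z_{\ge0},+)$ containing all large positive integers; its Frobenius number $F(H)$ is the largest integer $b$ with $b\notin H$. For a graded $P$-module $N$, the maximal generator degree is $b_0(N)=\inf\{b\mid P(\bigoplus_{j\le b}N_j)=N\}$, with $b_0(0)=-\infty$. The $t$-th symbolic power of an ideal $I$ in a Noetherian ring $P$ is $I^{(t)}=I^tP_W\cap P$, where $W$ is the complement of the union of the associated primes of $I$ and $P_W$ is the localization at $W$. *)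

theory Defs
  imports
    Complex_Main
    "HOL-Library.Extended_Real"
    "HOL-Library.Poly_Mapping"
    "HOL-Computational_Algebra.Fraction_Field"
begin

section \<open>Numerical semigroups\<close>

definition is_submonoid :: "nat set \<Rightarrow> bool"
  where "is_submonoid M \<longleftrightarrow> 0 \<in> M \<and> (\<forall>a\<in>M. \<forall>b\<in>M. a + b \<in> M)"

definition numerical_semigroup :: "nat set \<Rightarrow> bool"
  where "numerical_semigroup H \<longleftrightarrow> is_submonoid H \<and> (\<exists>N. \<forall>n\<ge>N. n \<in> H)"

definition minimally_generates :: "nat set \<Rightarrow> nat set \<Rightarrow> bool"
  where "minimally_generates S H \<longleftrightarrow>
    is_submonoid hull S = H \<and> (\<forall>T. T \<subset> S \<longrightarrow> is_submonoid hull T \<noteq> H)"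

text \<open>The Frobenius number is an integer: it is \<open>-1\<close> for the semigroup of all natural numbers.\<close>

definition frobenius_number :: "nat set \<Rightarrow> int"
  where "frobenius_number H = (GREATEST b::int. b \<notin> int ` H)"


section \<open>Ideals, localization and symbolic powers\<close>

text \<open>Ideals of a commutative ring are its submodules as a module over itself.\<close>

lemma module_mult: "module ((*) :: 'a::comm_ring_1 \<Rightarrow> 'a \<Rightarrow> 'a)"
  by unfold_locales (simp_all add: algebra_simps)

definition is_ideal :: "'a::comm_ring_1 set \<Rightarrow> bool"
  where "is_ideal = module.subspace (*)"

definition ideal_gen :: "'a::comm_ring_1 set \<Rightarrow> 'a set"
  where "ideal_gen = module.span (*)"

definition is_prime_ideal :: "'a::comm_ring_1 set \<Rightarrow> bool"
  where "is_prime_ideal Q \<longleftrightarrow>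
    is_ideal Q \<and> Q \<noteq> UNIV \<and> (\<forall>a b. a * b \<in> Q \<longrightarrow> a \<in> Q \<or> b \<in> Q)"

text \<open>The associated primes of an ideal \<open>I\<close> are those of the module \<open>P/I\<close>, i.e. the primes that
  are annihilators of the residue class of some element \<open>f\<close>.\<close>

definition associated_primes :: "'a::comm_ring_1 set \<Rightarrow> 'a set set"
  where "associated_primes I = {Q. is_prime_ideal Q \<and> (\<exists>f. Q = {a. a * f \<in> I})}"

definition ideal_power :: "'a::comm_ring_1 set \<Rightarrow> nat \<Rightarrow> 'a set"
  where "ideal_power I t = ideal_gen {\<Prod>i<t. f i | f. \<forall>i<t. f i \<in> I}"

text \<open>For a domain \<open>P\<close>, the localization \<open>P_W\<close> is realized as a subring of the fraction field.
  This is meaningful for multiplicatively closed \<open>W\<close> with \<open>0 \<notin> W\<close>.\<close>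

definition localization :: "'a::idom set \<Rightarrow> 'a fract set"
  where "localization W = {Fract a w | a w. w \<in> W}"

definition extended_ideal :: "'a::idom set \<Rightarrow> 'a set \<Rightarrow> 'a fract set"
  where "extended_ideal W J =
    {\<Sum>x\<in>T. c x * Fract x 1 | T c. finite T \<and> T \<subseteq> J \<and> (\<forall>x\<in>T. c x \<in> localization W)}"

definition symbolic_power :: "'a::idom set \<Rightarrow> nat \<Rightarrow> 'a set"
  where "symbolic_power I t =
    (let W = - \<Union>(associated_primes I)
     in {a. Fract a 1 \<in> extended_ideal W (ideal_power I t)})"


section \<open>Weighted polynomial rings\<close>

text \<open>Polynomials over \<open>'k\<close> in variables indexed by \<open>'n\<close>, as finitely supported coefficient
  functions on exponent vectors.\<close>

type_synonym ('n, 'k) mpoly = "('n \<Rightarrow>\<^sub>0 nat) \<Rightarrow>\<^sub>0 'k"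

definition eval_mpoly :: "('n::finite \<Rightarrow> 'k::comm_ring_1) \<Rightarrow> ('n, 'k) mpoly \<Rightarrow> 'k"
  where "eval_mpoly x f =
    (\<Sum>m\<in>Poly_Mapping.keys f. Poly_Mapping.lookup f m * (\<Prod>i\<in>UNIV. x i ^ Poly_Mapping.lookup m i))"

definition vanishing_ideal :: "('n::finite \<Rightarrow> 'k::comm_ring_1) set \<Rightarrow> ('n, 'k) mpoly set"
  where "vanishing_ideal C = {f. \<forall>x\<in>C. eval_mpoly x f = 0}"

definition monomial_curve :: "('n \<Rightarrow> nat) \<Rightarrow> ('n \<Rightarrow> 'k::comm_ring_1) set"
  where "monomial_curve h = {(\<lambda>i. \<tau> ^ h i) | \<tau>. True}"

definition weighted_degree :: "('n::finite \<Rightarrow> nat) \<Rightarrow> ('n \<Rightarrow>\<^sub>0 nat) \<Rightarrow> nat"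
  where "weighted_degree h m = (\<Sum>i\<in>UNIV. h i * Poly_Mapping.lookup m i)"

definition homogeneous_component ::
    "('n::finite \<Rightarrow> nat) \<Rightarrow> int \<Rightarrow> ('n, 'k::comm_ring_1) mpoly set"
  where "homogeneous_component h j = {f. \<forall>m\<in>Poly_Mapping.keys f. int (weighted_degree h m) = j}"

text \<open>Maximal generator degree of a homogeneous ideal \<open>N\<close>, whose component of degree \<open>j\<close> is
  the intersection of \<open>N\<close> with the component of the ring.  The bound \<open>b\<close> ranges over all
  integers, so that the zero ideal gets the value \<open>-\<infinity>\<close>.\<close>

definition max_gen_degree ::
    "('n::finite \<Rightarrow> nat) \<Rightarrow> ('n, 'k::comm_ring_1) mpoly set \<Rightarrow> ereal"
  where "max_gen_degree h N =
    Inf {ereal (of_int b) | b::int. ideal_gen (\<Union>j\<in>{..b}. N \<inter> homogeneous_component h j) = N}"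

lemma max_gen_degree_zero:
  "max_gen_degree h {0 :: ('n::finite, 'k::comm_ring_1) mpoly} = -\<infinity>"
proof -
  have "ideal_gen (\<Union>j\<in>{..b}. {0} \<inter> homogeneous_component h j) = {0 :: ('n, 'k) mpoly}" for b
  proof -
    have "(\<Union>j\<in>{..b}. {0 :: ('n, 'k) mpoly} \<inter> homogeneous_component h j) = {0}"
      by (auto simp: homogeneous_component_def)
    moreover have "module.span (*) {0} = {0 :: ('n, 'k) mpoly}"
      by (intro module.span_unique[OF module_mult])
        (auto simp: module.subspace_def[OF module_mult])
    ultimately show ?thesis
      by (simp add: ideal_gen_def)
  qed
  then have "max_gen_degree h {0 :: ('n, 'k) mpoly} \<le> ereal (of_int b)" for b
    unfolding max_gen_degree_def by (intro Inf_lower) auto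
  then have "max_gen_degree h {0 :: ('n, 'k) mpoly} \<le> ereal r" for r
    by (meson ereal_less_eq(3) of_int_floor_le order_trans)
  then show ?thesis
    by (rule ereal_bot)
qed

end

theory Submission
  imports Defs "HOL-Computational_Algebra.Polynomial"
begin

text \<open>
  Let \<open>\<phi> : P \<rightarrow> k[t]\<close>, \<open>x\<^sub>i \<mapsto> t\<^bsup>h\<^sub>i\<^esup>\<close>, be the parametrization of the curve (\<open>curve_poly\<close>).
  Since \<open>k\<close> is infinite, \<open>\<pp>\<close> is the kernel of \<open>\<phi>\<close>; hence it is a prime and homogeneous ideal, and
  \<open>\<pp>\<^sup>(\<^sup>2\<^sup>)\<close> consists of all \<open>f\<close> with \<open>w f \<in> \<pp>\<^sup>2\<close> for some \<open>w \<notin> \<pp>\<close>.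

  The idea is that in degrees above the Frobenius number \<open>F\<close> the ring \<open>P/\<pp> \<cong> k[H]\<close> agrees with
  \<open>k[t]\<close>: each of its components is a line, and multiplication by \<open>x\<^sub>i\<close> is bijective between them.
  Let \<open>\<pp>\<close> be generated in degrees at most \<open>b\<close>, and let \<open>f \<in> \<pp>\<^sup>(\<^sup>2\<^sup>)\<close> be homogeneous of degree
  \<open>d > b + h\<^sub>i + F\<close>. Write \<open>f = \<Sum> a\<^sub>g g\<close> with generators \<open>g\<close> of \<open>\<pp>\<close>. Every coefficient \<open>a\<^sub>g\<close> has degree
  \<open>d - deg g > h\<^sub>i + F\<close>, so \<open>a\<^sub>g\<close> is congruent to some \<open>x\<^sub>i a'\<^sub>g\<close> modulo \<open>\<pp>\<close>. With
  \<open>f' = \<Sum> a'\<^sub>g g\<close> this gives \<open>f - x\<^sub>i f' \<in> \<pp>\<^sup>2\<close>. Thus \<open>x\<^sub>i f' \<in> \<pp>\<^sup>(\<^sup>2\<^sup>)\<close>, and because \<open>x\<^sub>i \<notin> \<pp>\<close> even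
  \<open>f' \<in> \<pp>\<^sup>(\<^sup>2\<^sup>)\<close> (lemma \<open>symbolic_square_divide_by_variable\<close>).

  So modulo \<open>\<pp>\<^sup>2\<close>, which is generated in degrees at most \<open>2b\<close>, the element \<open>f\<close> is a multiple of an
  element of \<open>\<pp>\<^sup>(\<^sup>2\<^sup>)\<close> of smaller degree. Induction on \<open>d\<close> shows that \<open>\<pp>\<^sup>(\<^sup>2\<^sup>)\<close> is generated in degrees
  at most \<open>max (b + h\<^sub>i + F) (2 b)\<close> (lemma \<open>symbolic_square_bounded_generators\<close>); the theorem is
  the case of the last variable. The induction handles homogeneous elements only, which suffices
  because \<open>\<pp>\<^sup>(\<^sup>2\<^sup>)\<close> is a homogeneous ideal (lemma \<open>homogeneous_symbolic_power_2\<close>).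
\<close>

section \<open>Symbolic powers of prime ideals\<close>

interpretation ideal: module "(*) :: 'a::comm_ring_1 \<Rightarrow> 'a \<Rightarrow> 'a"
  by (rule module_mult)

(* Over the regular module this rule reassociates products to the left, against mult.assoc. *)
declare ideal.scale_scale [simp del]

lemma ideal_power_2: "ideal_power I 2 = ideal_gen {f * g | f g. f \<in> I \<and> g \<in> I}"
proof -
  have "{\<Prod>i<2. f i | f. \<forall>i<2::nat. f i \<in> I} = {f * g | f g. f \<in> I \<and> g \<in> I}"
  proof safe
    fix f :: "nat \<Rightarrow> 'a" assume "\<forall>i<2. f i \<in> I"
    then show "\<exists>a b. (\<Prod>i<2. f i) = a * b \<and> a \<in> I \<and> b \<in> I"
      by (intro exI[of _ "f 0"] exI[of _ "f 1"]) (auto simp: numeral_2_eq_2)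
  next
    fix a b assume "a \<in> I" "b \<in> I"
    then show "\<exists>f. a * b = (\<Prod>i<2. f i) \<and> (\<forall>i<2::nat. f i \<in> I)"
      by (intro exI[of _ "\<lambda>i. if i = 0 then a else b"]) (auto simp: numeral_2_eq_2)
  qed
  then show ?thesis by (simp add: ideal_power_def)
qed

lemma ideal_power_2_subset: "is_ideal I \<Longrightarrow> ideal_power I 2 \<subseteq> I"
  unfolding ideal_power_2 ideal_gen_def is_ideal_def
  by (rule ideal.span_minimal) (auto intro: ideal.subspace_scale)

lemma mult_in_ideal_power_2: "f \<in> I \<Longrightarrow> g \<in> I \<Longrightarrow> f * g \<in> ideal_power I 2"
  unfolding ideal_power_2 ideal_gen_def by (rule ideal.span_base) auto

lemma is_ideal_ideal_power: "is_ideal (ideal_power I t)"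
  unfolding is_ideal_def ideal_power_def ideal_gen_def by (rule ideal.subspace_span)

lemma associated_primes_prime_ideal:
  assumes "is_prime_ideal Q"
  shows "associated_primes Q = {Q}"
proof (intro equalityI subsetI)
  fix A assume "A \<in> associated_primes Q"
  then obtain f where "is_prime_ideal A" and A: "A = {a. a * f \<in> Q}"
    by (auto simp: associated_primes_def)
  have ideal: "ideal.subspace Q"
    using assms by (simp add: is_prime_ideal_def is_ideal_def)
  have "f \<notin> Q"
    using \<open>is_prime_ideal A\<close> ideal.subspace_scale[OF ideal] unfolding A is_prime_ideal_def by blast
  moreover have "f * a \<in> Q" if "a \<in> Q" for a
    using ideal.subspace_scale[OF ideal that] .
  ultimately have "A = Q"
    using assms by (auto simp: A is_prime_ideal_def mult.commute)
  then show "A \<in> {Q}" by simp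
next
  fix A assume "A \<in> {Q}"
  moreover have "Q = {a. a * 1 \<in> Q}" by simp
  ultimately show "A \<in> associated_primes Q"
    using assms unfolding associated_primes_def by blast
qed

text \<open>The complement of a prime ideal is multiplicatively closed, so a finite sum of fractions has a
  common denominator in it.\<close>

lemma extended_ideal_common_denominator:
  fixes Q :: "'a::idom set"
  assumes Q: "is_prime_ideal Q" and J: "is_ideal J"
    and "z \<in> extended_ideal (- Q) J"
  shows "\<exists>w y. w \<notin> Q \<and> y \<in> J \<and> z = Fract y w"
proof -
  have sub: "ideal.subspace J" using J by (simp add: is_ideal_def)
  have "0 \<in> Q" and one: "1 \<notin> Q"
    using Q ideal.subspace_scale[of Q 1] ideal.subspace_0[of Q]
    by (auto simp: is_prime_ideal_def is_ideal_def)
  obtain T c where z: "z = (\<Sum>x\<in>T. c x * Fract x 1)" and T: "finite T" "T \<subseteq> J"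
      "\<forall>x\<in>T. c x \<in> localization (- Q)"
    using assms(3) by (auto simp: extended_ideal_def)
  from T have "\<exists>w y. w \<notin> Q \<and> y \<in> J \<and> (\<Sum>x\<in>T. c x * Fract x 1) = Fract y w"
  proof (induction T)
    case empty
    have "(0::'a fract) = Fract 0 1" by (simp add: Zero_fract_def)
    with one ideal.subspace_0[OF sub] show ?case by auto
  next
    case (insert x T)
    then obtain w y where w: "w \<notin> Q" "y \<in> J" "(\<Sum>x\<in>T. c x * Fract x 1) = Fract y w"
      by auto
    have "c x \<in> localization (- Q)" using insert.prems by simp
    then obtain a v where v: "v \<notin> Q" "c x = Fract a v"
      by (auto simp: localization_def)
    have ne: "v \<noteq> 0" "w \<noteq> 0" using v(1) w(1) \<open>0 \<in> Q\<close> by auto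
    have "v * w \<notin> Q" using v(1) w(1) Q by (auto simp: is_prime_ideal_def)
    moreover have "a * x * w + y * v \<in> J"
    proof (rule ideal.subspace_add[OF sub])
      show "a * x * w \<in> J"
        using insert.prems(1) ideal.subspace_scale[OF sub, of x "a * w"]
        by (simp add: mult.assoc mult.commute[of x w])
      show "y * v \<in> J"
        using ideal.subspace_scale[OF sub w(2), of v] by (simp add: mult.commute[of y v])
    qed
    moreover have "(\<Sum>x\<in>insert x T. c x * Fract x 1) = Fract (a * x * w + y * v) (v * w)"
      using insert.hyps w(3) v(2) ne by (simp add: add_fract mult_fract)
    ultimately show ?case by blast
  qed
  then show ?thesis by (simp add: z)
qed

text \<open>A prime ideal is its only associated prime, so the elements that become invertible are exactly
  those outside of it. This description replaces the fraction field in all that follows.\<close>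

lemma symbolic_power_prime_ideal:
  fixes Q :: "'a::idom set"
  assumes Q: "is_prime_ideal Q"
  shows "symbolic_power Q t = {a. \<exists>w. w \<notin> Q \<and> w * a \<in> ideal_power Q t}"
proof -
  have "0 \<in> Q"
    using Q ideal.subspace_0 by (auto simp: is_prime_ideal_def is_ideal_def)
  have "Fract a 1 \<in> extended_ideal (- Q) (ideal_power Q t) \<longleftrightarrow>
      (\<exists>w. w \<notin> Q \<and> w * a \<in> ideal_power Q t)" for a
  proof
    assume "Fract a 1 \<in> extended_ideal (- Q) (ideal_power Q t)"
    then obtain w y where w: "w \<notin> Q" "y \<in> ideal_power Q t" "Fract a 1 = Fract y w"
      using extended_ideal_common_denominator[OF Q is_ideal_ideal_power] by blast
    then have "w \<noteq> 0" using \<open>0 \<in> Q\<close> by auto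
    then have "w * a = y"
      using w(3) by (simp add: eq_fract mult.commute)
    with w show "\<exists>w. w \<notin> Q \<and> w * a \<in> ideal_power Q t" by auto
  next
    assume "\<exists>w. w \<notin> Q \<and> w * a \<in> ideal_power Q t"
    then obtain w where w: "w \<notin> Q" "w * a \<in> ideal_power Q t" by auto
    then have "w \<noteq> 0" using \<open>0 \<in> Q\<close> by auto
    then have "Fract a 1 = (\<Sum>x\<in>{w * a}. Fract 1 w * Fract x 1)"
      by (simp add: mult_fract eq_fract)
    moreover have "Fract 1 w \<in> localization (- Q)"
      using w by (auto simp: localization_def)
    ultimately show "Fract a 1 \<in> extended_ideal (- Q) (ideal_power Q t)"
      using w unfolding extended_ideal_def
      by (intro CollectI exI[of _ "{w * a}"] exI[of _ "\<lambda>_. Fract 1 w"]) simp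
  qed
  then show ?thesis
    by (simp add: symbolic_power_def associated_primes_prime_ideal[OF Q])
qed

lemma is_ideal_symbolic_power:
  fixes Q :: "'a::idom set"
  assumes Q: "is_prime_ideal Q"
  shows "is_ideal (symbolic_power Q t)"
  unfolding is_ideal_def symbolic_power_prime_ideal[OF Q]
proof (rule ideal.subspaceI; safe?)
  have J: "ideal.subspace (ideal_power Q t)"
    using is_ideal_ideal_power by (simp add: is_ideal_def)
  show "\<exists>w. w \<notin> Q \<and> w * 0 \<in> ideal_power Q t"
    using Q ideal.subspace_0[OF J] by (auto simp: is_prime_ideal_def)
  fix a v assume v: "v \<notin> Q" "v * a \<in> ideal_power Q t"
  have "v * (r * a) \<in> ideal_power Q t" for r
    using ideal.subspace_scale[OF J v(2), of r] by (simp add: ac_simps)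
  with v show "\<exists>w. w \<notin> Q \<and> w * (r * a) \<in> ideal_power Q t" for r by blast
  fix b w assume w: "w \<notin> Q" "w * b \<in> ideal_power Q t"
  have "v * w \<notin> Q" using v w Q by (auto simp: is_prime_ideal_def)
  moreover have "v * w * (a + b) \<in> ideal_power Q t"
  proof -
    have "v * w * (a + b) = w * (v * a) + v * (w * b)" by (simp add: algebra_simps)
    then show ?thesis
      using ideal.subspace_add[OF J ideal.subspace_scale[OF J v(2), of w]
          ideal.subspace_scale[OF J w(2), of v]]
      by simp
  qed
  ultimately show "\<exists>w. w \<notin> Q \<and> w * (a + b) \<in> ideal_power Q t" by blast
qed

lemma ideal_power_subset_symbolic_power:
  fixes Q :: "'a::idom set"
  assumes Q: "is_prime_ideal Q"
  shows "ideal_power Q t \<subseteq> symbolic_power Q t"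
proof -
  have "1 \<notin> Q"
    using Q ideal.subspace_scale[of Q 1] by (auto simp: is_prime_ideal_def is_ideal_def)
  then show ?thesis
    unfolding symbolic_power_prime_ideal[OF Q] by (auto intro!: exI[of _ 1])
qed

lemma symbolic_power_2_subset:
  fixes Q :: "'a::idom set"
  assumes Q: "is_prime_ideal Q"
  shows "symbolic_power Q 2 \<subseteq> Q"
proof
  fix a assume "a \<in> symbolic_power Q 2"
  then obtain w where "w \<notin> Q" "w * a \<in> ideal_power Q 2"
    by (auto simp: symbolic_power_prime_ideal[OF Q])
  moreover have "is_ideal Q" using Q by (simp add: is_prime_ideal_def)
  ultimately have "w \<notin> Q" "w * a \<in> Q" using ideal_power_2_subset by auto
  then show "a \<in> Q" using Q by (auto simp: is_prime_ideal_def)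
qed

text \<open>Symbolic powers of a prime ideal are primary. This is what allows a factor to be divided out of
  an element of the symbolic square.\<close>

lemma symbolic_power_cancel:
  fixes Q :: "'a::idom set"
  assumes Q: "is_prime_ideal Q" and "w \<notin> Q" "w * a \<in> symbolic_power Q t"
  shows "a \<in> symbolic_power Q t"
proof -
  obtain v where "v \<notin> Q" "v * (w * a) \<in> ideal_power Q t"
    using assms(3) by (auto simp: symbolic_power_prime_ideal[OF Q])
  moreover have "v * w \<notin> Q" using \<open>v \<notin> Q\<close> \<open>w \<notin> Q\<close> Q by (auto simp: is_prime_ideal_def)
  ultimately show ?thesis
    unfolding symbolic_power_prime_ideal[OF Q] mult.assoc[symmetric] by blast
qed

section \<open>The grading of the polynomial ring\<close>

text \<open>Two additive maps that agree on monomials agree everywhere. The product formulas for homogeneous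
  components and for the parametrization of the curve are checked in this way.\<close>

lemma poly_mapping_single_induct [case_names single add]:
  assumes "\<And>m c. P (Poly_Mapping.single m c)" and "\<And>f g. P f \<Longrightarrow> P g \<Longrightarrow> P (f + g)"
  shows "P (f :: 'a \<Rightarrow>\<^sub>0 'b::comm_monoid_add)"
proof (induction f rule: update_induct)
  case const
  show ?case using assms(1)[of _ 0] by simp
next
  case (update f a b)
  have "Poly_Mapping.update a b f = f + Poly_Mapping.single a b"
    by (rule poly_mapping_eqI)
      (use update in \<open>auto simp: lookup_update lookup_add lookup_single when_def in_keys_iff\<close>)
  with update assms show ?case by simp
qed

lemma weighted_degree_add: "weighted_degree h (m + n) = weighted_degree h m + weighted_degree h n"
  by (simp add: weighted_degree_def lookup_add algebra_simps sum.distrib)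

lemma weighted_degree_single: "weighted_degree h (Poly_Mapping.single i 1) = h i"
proof -
  have "weighted_degree h (Poly_Mapping.single i 1) = (\<Sum>j\<in>UNIV. if j = i then h j else 0)"
    unfolding weighted_degree_def
    by (rule sum.cong) (auto simp: lookup_single when_def)
  then show ?thesis by simp
qed

lemma homogeneous_component_negative:
  "f \<in> homogeneous_component h j \<Longrightarrow> j < 0 \<Longrightarrow> f = 0"
  by (force simp: homogeneous_component_def simp flip: keys_eq_empty)

lemma homogeneous_component_mult:
  assumes "f \<in> homogeneous_component h i" "g \<in> homogeneous_component h j"
  shows "f * g \<in> homogeneous_component h (i + j)"
  using assms keys_mult[of f g]
  by (force simp: homogeneous_component_def weighted_degree_add)

lemma homogeneous_component_sum:
  assumes "\<And>x. x \<in> T \<Longrightarrow> f x \<in> homogeneous_component h j"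
  shows "sum f T \<in> homogeneous_component h j"
  using assms keys_sum[of f T] by (fastforce simp: homogeneous_component_def)

definition component :: "('n::finite \<Rightarrow> nat) \<Rightarrow> nat \<Rightarrow> ('n, 'k::comm_ring_1) mpoly \<Rightarrow> ('n, 'k) mpoly"
  where "component h d = Poly_Mapping.mapp (\<lambda>m c. c when weighted_degree h m = d)"

lemma lookup_component:
  "Poly_Mapping.lookup (component h d f) m = (Poly_Mapping.lookup f m when weighted_degree h m = d)"
  by (auto simp: component_def lookup_mapp when_def in_keys_iff)

lemma component_add: "component h d (f + g) = component h d f + component h d g"
  by (rule poly_mapping_eqI) (simp add: lookup_component lookup_add when_add_distrib)

lemma component_0 [simp]: "component h d 0 = 0"
  by (rule poly_mapping_eqI) (simp add: lookup_component)

lemma component_sum: "component h d (sum f T) = (\<Sum>x\<in>T. component h d (f x))"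
  by (induction T rule: infinite_finite_induct) (simp_all add: component_add)

lemma component_single:
  "component h d (Poly_Mapping.single m c) =
    (if weighted_degree h m = d then Poly_Mapping.single m c else 0)"
  by (rule poly_mapping_eqI) (auto simp: lookup_component lookup_single when_def)

lemma component_in: "component h d f \<in> homogeneous_component h (int d)"
  by (auto simp: homogeneous_component_def in_keys_iff lookup_component)

lemma component_homogeneous:
  assumes "f \<in> homogeneous_component h (int e)"
  shows "component h d f = (if d = e then f else 0)"
  by (rule poly_mapping_eqI)
    (use assms in \<open>auto simp: homogeneous_component_def in_keys_iff lookup_component when_def\<close>)

lemma sum_components: "f = (\<Sum>d\<in>weighted_degree h ` Poly_Mapping.keys f. component h d f)"
proof (rule poly_mapping_eqI)
  fix m
  have "Poly_Mapping.lookup (\<Sum>d\<in>weighted_degree h ` Poly_Mapping.keys f. component h d f) m =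
      (\<Sum>d\<in>weighted_degree h ` Poly_Mapping.keys f. if d = weighted_degree h m then Poly_Mapping.lookup f m else 0)"
    by (auto simp: lookup_sum lookup_component when_def intro!: sum.cong)
  also have "\<dots> = Poly_Mapping.lookup f m"
    by (auto simp: sum.delta in_keys_iff)
  finally show "Poly_Mapping.lookup f m = Poly_Mapping.lookup (\<Sum>d\<in>weighted_degree h ` Poly_Mapping.keys f. component h d f) m" ..
qed

lemma component_mult:
  "component h d (f * g) = (\<Sum>i\<le>d. component h i f * component h (d - i) g)"
proof (induction f rule: poly_mapping_single_induct)
  case (single m c)
  show ?case
  proof (induction g rule: poly_mapping_single_induct)
    case (single n e)
    have "(\<Sum>i\<le>d. component h i (Poly_Mapping.single m c) * component h (d - i) (Poly_Mapping.single n e))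
      = (\<Sum>i\<le>d. if i = weighted_degree h m then
          (if weighted_degree h n = d - i then Poly_Mapping.single (m + n) (c * e) else 0) else 0)"
      by (rule sum.cong) (auto simp: component_single mult_single)
    then show ?case
      by (auto simp: mult_single component_single weighted_degree_add sum.delta)
  qed (simp add: component_add distrib_left sum.distrib)
qed (simp add: component_add distrib_right sum.distrib)

lemma component_mult_homogeneous:
  assumes "g \<in> homogeneous_component h (int e)" "e \<le> d"
  shows "component h d (f * g) = component h (d - e) f * g"
proof -
  have "component h d (f * g) = (\<Sum>i\<le>d. if i = d - e then component h i f * g else 0)"
    unfolding component_mult using assms
    by (intro sum.cong) (auto simp: component_homogeneous)
  then show ?thesis by simp
qed

definition homogeneous :: "('n::finite \<Rightarrow> nat) \<Rightarrow> ('n, 'k::comm_ring_1) mpoly set \<Rightarrow> bool"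
  where "homogeneous h N \<longleftrightarrow> (\<forall>f\<in>N. \<forall>d. component h d f \<in> N)"

lemma homogeneous_ideal_gen:
  assumes "\<And>f d. f \<in> S \<Longrightarrow> component h d f \<in> ideal_gen S"
  shows "homogeneous h (ideal_gen S)"
  unfolding homogeneous_def
proof
  fix f assume "f \<in> ideal_gen S"
  then show "\<forall>d. component h d f \<in> ideal_gen S"
    unfolding ideal_gen_def
  proof (induction rule: ideal.span_induct_alt)
    case base
    then show ?case by (simp add: ideal.span_zero)
  next
    case (step c x y)
    then show ?case
      using assms unfolding ideal_gen_def component_add component_mult
      by (auto intro!: ideal.span_add ideal.span_sum ideal.span_scale)
  qed
qed

text \<open>A component of a product is a sum of products of components.\<close>

lemma homogeneous_ideal_power_2:
  assumes "homogeneous h I"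
  shows "homogeneous h (ideal_power I 2)"
  unfolding ideal_power_2
proof (rule homogeneous_ideal_gen, safe)
  fix f g d assume "f \<in> I" "g \<in> I"
  with assms show "component h d (f * g) \<in> ideal_gen {f * g | f g. f \<in> I \<and> g \<in> I}"
    unfolding ideal_gen_def component_mult homogeneous_def
    by (intro ideal.span_sum ideal.span_base) blast
qed

text \<open>Let \<open>w a \<in> Q\<^sup>2\<close> with \<open>w \<notin> Q\<close>, and let \<open>e\<close> be the smallest degree in which the component of \<open>w\<close>
  is not in \<open>Q\<close>. The component of \<open>w a\<close> in degree \<open>e + d\<close> is the sum of all \<open>w\<^sub>i a\<^sub>j\<close> with
  \<open>i + j = e + d\<close>. For \<open>i < e\<close> both factors are in \<open>Q\<close>, so the product is in \<open>Q\<^sup>2\<close>. For \<open>i > e\<close> the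
  degree \<open>j\<close> is below \<open>d\<close>, and \<open>a\<^sub>j\<close> is in the symbolic square by induction on \<open>d\<close>. What remains is \<open>w\<^sub>e a\<^sub>d\<close>, and \<open>w\<^sub>e\<close>
  cancels.\<close>

lemma homogeneous_symbolic_power_2:
  fixes h :: "'n::{finite, linorder} \<Rightarrow> nat" and Q :: "('n, 'k::idom) mpoly set"
  assumes Q: "is_prime_ideal Q" and hom: "homogeneous h Q"
  shows "homogeneous h (symbolic_power Q 2)"
  unfolding homogeneous_def
proof (intro ballI allI)
  fix a d assume a: "a \<in> symbolic_power Q 2"
  obtain w where "w \<notin> Q" and wa: "w * a \<in> ideal_power Q 2"
    using a by (auto simp: symbolic_power_prime_ideal[OF Q])
  have idQ: "ideal.subspace Q"
    using Q by (simp add: is_prime_ideal_def is_ideal_def)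
  have idS: "ideal.subspace (symbolic_power Q 2)"
    using is_ideal_symbolic_power[OF Q] by (simp add: is_ideal_def)
  have powS: "ideal_power Q 2 \<subseteq> symbolic_power Q 2"
    by (rule ideal_power_subset_symbolic_power[OF Q])
  have "\<exists>e. component h e w \<notin> Q"
  proof (rule ccontr)
    assume "\<nexists>e. component h e w \<notin> Q"
    then have "(\<Sum>d\<in>weighted_degree h ` Poly_Mapping.keys w. component h d w) \<in> Q"
      by (intro ideal.subspace_sum[OF idQ]) auto
    then show False using \<open>w \<notin> Q\<close> sum_components[of w h] by simp
  qed
  then obtain e where e: "component h e w \<notin> Q" and below: "\<And>i. i < e \<Longrightarrow> component h i w \<in> Q"
    using LeastI_ex[of "\<lambda>e. component h e w \<notin> Q"] not_less_Least[of _ "\<lambda>e. component h e w \<notin> Q"]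
    by blast
  show "component h d a \<in> symbolic_power Q 2"
  proof (induction d rule: less_induct)
    case (less d)
    have other: "component h i w * component h (e + d - i) a \<in> symbolic_power Q 2"
      if "i \<le> e + d" "i \<noteq> e" for i
    proof (cases "i < e")
      case True
      have "a \<in> Q" using a symbolic_power_2_subset[OF Q] by blast
      then have "component h (e + d - i) a \<in> Q"
        using hom unfolding homogeneous_def by blast
      with below[OF True] have "component h i w * component h (e + d - i) a \<in> ideal_power Q 2"
        by (rule mult_in_ideal_power_2)
      then show ?thesis using powS by blast
    next
      case False
      then have "component h (e + d - i) a \<in> symbolic_power Q 2"
        using that less.IH[of "e + d - i"] by simp
      then show ?thesis by (rule ideal.subspace_scale[OF idS])
    qed
    have "component h (e + d) (w * a) \<in> symbolic_power Q 2"
      using homogeneous_ideal_power_2[OF hom] wa powS unfolding homogeneous_def by blast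
    moreover have "component h (e + d) (w * a) = component h e w * component h d a +
        (\<Sum>i\<in>{..e + d} - {e}. component h i w * component h (e + d - i) a)"
      unfolding component_mult by (subst sum.remove[of "{..e + d}" e]) simp_all
    moreover have "(\<Sum>i\<in>{..e + d} - {e}. component h i w * component h (e + d - i) a) \<in> symbolic_power Q 2"
      using other by (intro ideal.subspace_sum[OF idS]) auto
    ultimately have "component h e w * component h d a \<in> symbolic_power Q 2"
      using ideal.subspace_diff[OF idS, of "component h (e + d) (w * a)"] by fastforce
    then show ?case by (rule symbolic_power_cancel[OF Q e])
  qed
qed

section \<open>Generators of bounded degree\<close>

lemma ideal_gen_bounded_eqI:
  assumes ideal: "is_ideal N" and hom: "homogeneous h N"
    and gen: "\<And>d f. f \<in> N \<Longrightarrow> f \<in> homogeneous_component h (int d) \<Longrightarrow>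
      f \<in> ideal_gen (\<Union>j\<in>{..b}. N \<inter> homogeneous_component h j)"
  shows "ideal_gen (\<Union>j\<in>{..b}. N \<inter> homogeneous_component h j) = N" (is "ideal_gen ?G = N")
proof
  show "ideal_gen ?G \<subseteq> N"
    unfolding ideal_gen_def using ideal
    by (intro ideal.span_minimal) (auto simp: is_ideal_def)
  show "N \<subseteq> ideal_gen ?G"
  proof
    fix f assume "f \<in> N"
    then have "component h d f \<in> ideal_gen ?G" for d
      using hom gen[OF _ component_in] by (auto simp: homogeneous_def)
    then have "(\<Sum>d\<in>weighted_degree h ` Poly_Mapping.keys f. component h d f) \<in> ideal_gen ?G"
      unfolding ideal_gen_def by (intro ideal.span_sum)
    then show "f \<in> ideal_gen ?G"
      by (simp flip: sum_components)
  qed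
qed

text \<open>The products of two homogeneous generators of \<open>I\<close> generate \<open>I\<^sup>2\<close>. They are looked for in a larger
  ideal \<open>N\<close>, since the generating sets in question are the components of the symbolic square.\<close>

lemma ideal_power_2_bounded_generators:
  assumes gen: "ideal_gen (\<Union>j\<in>{..b}. I \<inter> homogeneous_component h j) = I"
    and sub: "ideal_power I 2 \<subseteq> N"
  shows "ideal_power I 2 \<subseteq> ideal_gen (\<Union>j\<in>{..2 * b}. N \<inter> homogeneous_component h j)"
    (is "_ \<subseteq> ideal_gen ?G2")
proof -
  let ?G = "\<Union>j\<in>{..b}. I \<inter> homogeneous_component h j"
  have GG: "x * y \<in> ideal.span ?G2" if xy: "x \<in> ?G" "y \<in> ?G" for x y
  proof (rule ideal.span_base)
    from xy obtain i j where "i \<le> b" "j \<le> b" "x \<in> homogeneous_component h i"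
        "y \<in> homogeneous_component h j" "x \<in> I" "y \<in> I"
      by auto
    then show "x * y \<in> ?G2"
      using homogeneous_component_mult[of x h i y j] mult_in_ideal_power_2[of x I y] sub
      by (intro UN_I[of "i + j"]) auto
  qed
  have G1: "x * y \<in> ideal.span ?G2" if x: "x \<in> ?G" and y: "y \<in> ideal.span ?G" for x y
    using y
  proof (induction rule: ideal.span_induct_alt)
    case (step c y z)
    then show ?case
      using ideal.span_scale[OF GG[OF x step(1)], of c] ideal.span_add
      by (force simp: algebra_simps)
  qed (simp add: ideal.span_zero)
  have "x * y \<in> ideal.span ?G2" if x: "x \<in> ideal.span ?G" and y: "y \<in> ideal.span ?G" for x y
    using x
  proof (induction rule: ideal.span_induct_alt)
    case (step c x z)
    then show ?case
      using ideal.span_scale[OF G1[OF step(1) y], of c] ideal.span_add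
      by (force simp: algebra_simps)
  qed (simp add: ideal.span_zero)
  then show ?thesis
    using gen unfolding ideal_power_2 ideal_gen_def
    by (intro ideal.span_minimal ideal.subspace_span) auto
qed

section \<open>The ideal of the monomial curve\<close>

text \<open>The ring homomorphism sending \<open>x\<^sub>i\<close> to \<open>t\<^bsup>h\<^sub>i\<^esup>\<close>. Its values are polynomials, rather than functions
  on the curve, so that degrees can be read off from their coefficients.\<close>

definition curve_poly :: "('n::finite \<Rightarrow> nat) \<Rightarrow> ('n, 'k::comm_ring_1) mpoly \<Rightarrow> 'k poly"
  where "curve_poly h f = (\<Sum>m\<in>Poly_Mapping.keys f. monom (Poly_Mapping.lookup f m) (weighted_degree h m))"

lemma curve_poly_0 [simp]: "curve_poly h 0 = 0"
  by (simp add: curve_poly_def)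

lemma curve_poly_add: "curve_poly h (f + g) = curve_poly h f + curve_poly h g"
  unfolding curve_poly_def
  by (rule setsum_keys_plus_distrib) (simp_all add: add_monom)

lemma curve_poly_single: "curve_poly h (Poly_Mapping.single m c) = monom c (weighted_degree h m)"
  by (simp add: curve_poly_def)

lemma curve_poly_mult: "curve_poly h (f * g) = curve_poly h f * curve_poly h g"
proof (induction f rule: poly_mapping_single_induct)
  case (single m c)
  show ?case
  proof (induction g rule: poly_mapping_single_induct)
    case (single n e)
    show ?case by (simp add: mult_single curve_poly_single weighted_degree_add mult_monom)
  qed (simp add: curve_poly_add distrib_left)
qed (simp add: curve_poly_add distrib_right)

lemma curve_poly_diff: "curve_poly h (f - g) = curve_poly h f - curve_poly h g"
  using curve_poly_add[of h "f - g" g] by (simp add: algebra_simps)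

lemma curve_poly_component: "curve_poly h (component h d f) = monom (coeff (curve_poly h f) d) d"
proof (induction f rule: poly_mapping_single_induct)
  case (add f g)
  then show ?case by (simp add: component_add curve_poly_add add_monom)
qed (simp add: component_single curve_poly_single)

lemma poly_curve_poly: "poly (curve_poly h f) \<tau> = eval_mpoly (\<lambda>i. \<tau> ^ h i) f"
  by (simp add: curve_poly_def eval_mpoly_def poly_sum poly_monom weighted_degree_def
      power_sum power_mult)

text \<open>A polynomial vanishing on an infinite domain is zero.\<close>

lemma vanishing_ideal_monomial_curve:
  fixes h :: "'n::finite \<Rightarrow> nat"
  assumes "infinite (UNIV :: 'k::idom set)"
  shows "vanishing_ideal (monomial_curve h) = {f :: ('n, 'k) mpoly. curve_poly h f = 0}"
proof -
  have "(\<forall>\<tau>. poly p \<tau> = 0) \<longleftrightarrow> p = 0" for p :: "'k poly"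
  proof
    assume "\<forall>\<tau>. poly p \<tau> = 0"
    then have "{\<tau>. poly p \<tau> = 0} = UNIV" by auto
    then show "p = 0" using poly_roots_finite[of p] assms by metis
  qed simp
  moreover have "vanishing_ideal (monomial_curve h) =
      {f :: ('n, 'k) mpoly. \<forall>\<tau>. eval_mpoly (\<lambda>i. \<tau> ^ h i) f = 0}"
    by (auto simp: vanishing_ideal_def monomial_curve_def)
  ultimately show ?thesis
    by (simp flip: poly_curve_poly)
qed

lemma is_prime_ideal_curve:
  "is_prime_ideal {f :: ('n::finite, 'k::idom) mpoly. curve_poly h f = 0}"
proof -
  have "curve_poly h 1 = (1 :: 'k poly)"
    using curve_poly_single[of h 0 "1 :: 'k"] by (simp add: weighted_degree_def)
  then have "(1 :: ('n, 'k) mpoly) \<notin> {f. curve_poly h f = 0}" by simp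
  then have "{f :: ('n, 'k) mpoly. curve_poly h f = 0} \<noteq> UNIV" by blast
  then show ?thesis
    unfolding is_prime_ideal_def is_ideal_def
    by (auto intro!: ideal.subspaceI simp: curve_poly_add curve_poly_mult)
qed

lemma homogeneous_curve: "homogeneous h {f. curve_poly h f = 0}"
  by (simp add: homogeneous_def curve_poly_component)

lemma monomial_notin_curve:
  "Poly_Mapping.single m 1 \<notin> {f :: ('n::finite, 'k::idom) mpoly. curve_poly h f = 0}"
  by (simp add: curve_poly_single monom_eq_0_iff)

text \<open>A homogeneous element is determined modulo the ideal of the curve by its degree and one scalar,
  the coefficient of \<open>t\<^bsup>n + h\<^sub>i\<^esup>\<close> in its image. Any monomial of degree \<open>n\<close>, multiplied by that scalar and
  by \<open>x\<^sub>i\<close>, has the same image.\<close>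

lemma curve_divide_by_variable:
  fixes h :: "'n::finite \<Rightarrow> nat" and a :: "('n, 'k::comm_ring_1) mpoly"
  assumes a: "a \<in> homogeneous_component h (int (n + h i))"
    and n: "n = weighted_degree h m"
  shows "\<exists>a'. a' \<in> homogeneous_component h (int n) \<and>
    curve_poly h (a - Poly_Mapping.single (Poly_Mapping.single i 1) 1 * a') = 0"
proof -
  define c where "c = coeff (curve_poly h a) (n + h i)"
  have "curve_poly h a = monom c (n + h i)"
    using curve_poly_component[of h "n + h i" a] component_homogeneous[OF a, of "n + h i"]
    by (simp add: c_def)
  then have "curve_poly h (a - Poly_Mapping.single (Poly_Mapping.single i 1) 1 *
      Poly_Mapping.single m c) = 0"
    by (simp add: curve_poly_diff mult_single curve_poly_single weighted_degree_add
        weighted_degree_single[unfolded One_nat_def] n add.commute)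
  moreover have "Poly_Mapping.single m c \<in> homogeneous_component h (int n)"
    by (auto simp: homogeneous_component_def n)
  ultimately show ?thesis by blast
qed

text \<open>Write \<open>f = \<Sum> a\<^sub>g g\<close> with homogeneous generators \<open>g\<close> and homogeneous coefficients. Replacing \<open>a\<^sub>g\<close> by \<open>x\<^sub>i a'\<^sub>g\<close> changes \<open>a\<^sub>g g\<close> by an element of \<open>Q\<^sup>2\<close>, as
  \<open>a\<^sub>g - x\<^sub>i a'\<^sub>g\<close> and \<open>g\<close> are both in \<open>Q\<close>. The bound on \<open>d\<close> makes the degree of every \<open>a'\<^sub>g\<close> larger
  than \<open>F\<close>, so that a monomial of this degree exists.\<close>

lemma symbolic_square_divide_by_variable:
  fixes h :: "'n::{finite, linorder} \<Rightarrow> nat" and Q :: "('n, 'k::idom) mpoly set"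
  assumes Q: "Q = {f. curve_poly h f = 0}"
    and gen: "ideal_gen (\<Union>j\<in>{..b}. Q \<inter> homogeneous_component h j) = Q"
    and large: "\<And>n. n > F \<Longrightarrow> \<exists>m. int (weighted_degree h m) = n"
    and f: "f \<in> symbolic_power Q 2" "f \<in> homogeneous_component h (int d)"
    and d: "int d > b + int (h i) + F" "F \<ge> - 1"
  shows "\<exists>f'. f' \<in> symbolic_power Q 2 \<and> f' \<in> homogeneous_component h (int d - int (h i)) \<and>
    f - Poly_Mapping.single (Poly_Mapping.single i 1) 1 * f' \<in> ideal_power Q 2"
proof -
  let ?x = "Poly_Mapping.single (Poly_Mapping.single i 1) 1 :: ('n, 'k) mpoly"
  let ?G = "\<Union>j\<in>{..b}. Q \<inter> homogeneous_component h j"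
  have prime: "is_prime_ideal Q" unfolding Q by (rule is_prime_ideal_curve)
  have "f \<in> ideal.span ?G"
    using f(1) symbolic_power_2_subset[OF prime] gen by (auto simp: ideal_gen_def)
  then obtain T c where T: "finite T" "T \<subseteq> ?G" and fc: "f = (\<Sum>g\<in>T. c g * g)"
    by (auto simp: ideal.span_explicit)
  \<comment> \<open>The zero polynomial lies in every component, including those of negative degree. So a
    generator is zero or has a natural number as its degree.\<close>
  have "\<exists>e. g \<in> homogeneous_component h (int e) \<and> (g = 0 \<or> int e \<le> b)" if "g \<in> T" for g
  proof -
    from that T obtain j where j: "j \<le> b" "g \<in> homogeneous_component h j" by auto
    show ?thesis
    proof (cases "j < 0")
      case True
      then have "g = 0" using j homogeneous_component_negative by blast
      then show ?thesis by (auto simp: homogeneous_component_def)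
    next
      case False
      then show ?thesis using j by (intro exI[of _ "nat j"]) auto
    qed
  qed
  then obtain e where e: "\<And>g. g \<in> T \<Longrightarrow> g \<in> homogeneous_component h (int (e g))"
      "\<And>g. g \<in> T \<Longrightarrow> g = 0 \<or> int (e g) \<le> b"
    by metis
  have "\<exists>a'. a' * g \<in> homogeneous_component h (int d - int (h i)) \<and>
      component h d (c g * g) - ?x * (a' * g) \<in> ideal_power Q 2" if g: "g \<in> T" for g
  proof (cases "g = 0")
    case True
    then show ?thesis
      using is_ideal_ideal_power[of Q 2]
      by (auto simp: homogeneous_component_def is_ideal_def ideal.subspace_0)
  next
    case False
    then have eb: "int (e g) \<le> b" using e(2) g by blast
    define n where "n = d - e g - h i"
    have n: "int n = int d - int (e g) - int (h i)" "d - e g = n + h i" "e g \<le> d"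
      using eb d by (auto simp: n_def)
    have "int n > F" using n(1) eb d by linarith
    then obtain m where m: "n = weighted_degree h m"
      using large[of "int n"] by (metis of_nat_eq_iff)
    obtain a' where a': "a' \<in> homogeneous_component h (int n)"
        "component h (d - e g) (c g) - ?x * a' \<in> Q"
      using curve_divide_by_variable[OF _ m, of "component h (d - e g) (c g)" i]
        component_in[of h "d - e g" "c g"] n(2) unfolding Q by auto
    have "component h d (c g * g) - ?x * (a' * g) = (component h (d - e g) (c g) - ?x * a') * g"
      using component_mult_homogeneous[OF e(1)[OF g] n(3), of "c g"] by (simp add: algebra_simps)
    moreover have "g \<in> Q" using g T by auto
    moreover have "a' * g \<in> homogeneous_component h (int d - int (h i))"
      using homogeneous_component_mult[OF a'(1) e(1)[OF g]] n by simp
    ultimately show ?thesis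
      using mult_in_ideal_power_2[OF a'(2)] by auto
  qed
  then obtain a' where a': "\<And>g. g \<in> T \<Longrightarrow> a' g * g \<in> homogeneous_component h (int d - int (h i))"
      "\<And>g. g \<in> T \<Longrightarrow> component h d (c g * g) - ?x * (a' g * g) \<in> ideal_power Q 2"
    by metis
  define f' where "f' = (\<Sum>g\<in>T. a' g * g)"
  \<comment> \<open>Taking the component of degree \<open>d\<close> makes the coefficients of \<open>f\<close> homogeneous.\<close>
  have "f = component h d f"
    using component_homogeneous[OF f(2)] by simp
  also have "\<dots> = component h d (\<Sum>g\<in>T. c g * g)"
    using fc by (rule arg_cong)
  also have "\<dots> = (\<Sum>g\<in>T. component h d (c g * g))"
    by (rule component_sum)
  finally have "f - ?x * f' = (\<Sum>g\<in>T. component h d (c g * g) - ?x * (a' g * g))"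
    by (simp add: f'_def sum_subtractf sum_distrib_left)
  also have "\<dots> \<in> ideal_power Q 2"
    using is_ideal_ideal_power[of Q 2] a'(2) unfolding is_ideal_def
    by (intro ideal.subspace_sum)
  finally have diff: "f - ?x * f' \<in> ideal_power Q 2" .
  then have "f - ?x * f' \<in> symbolic_power Q 2"
    using ideal_power_subset_symbolic_power[OF prime] by blast
  from ideal.subspace_diff[OF is_ideal_symbolic_power[OF prime, unfolded is_ideal_def] f(1) this]
  have "?x * f' \<in> symbolic_power Q 2" by simp
  then have "f' \<in> symbolic_power Q 2"
    using symbolic_power_cancel[OF prime] monomial_notin_curve unfolding Q by blast
  moreover have "f' \<in> homogeneous_component h (int d - int (h i))"
    unfolding f'_def using a'(1) by (rule homogeneous_component_sum)
  ultimately show ?thesis using diff by blast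
qed

text \<open>An element whose degree exceeds \<open>B\<close> is, up to \<open>Q\<^sup>2\<close>, a multiple of \<open>x\<^sub>i\<close> within the symbolic square;
  as \<open>x\<^sub>i\<close> has positive degree, the cofactor is covered by the induction hypothesis.\<close>

lemma symbolic_square_bounded_generators:
  fixes h :: "'n::{finite, linorder} \<Rightarrow> nat" and Q :: "('n, 'k::idom) mpoly set"
  assumes Q: "Q = {f. curve_poly h f = 0}"
    and gen: "ideal_gen (\<Union>j\<in>{..b}. Q \<inter> homogeneous_component h j) = Q"
    and large: "\<And>n. n > F \<Longrightarrow> \<exists>m. int (weighted_degree h m) = n"
    and F: "F \<ge> - 1" and pos: "0 < h i"
    and B: "b + int (h i) + F \<le> B" "2 * b \<le> B"
  shows "ideal_gen (\<Union>j\<in>{..B}. symbolic_power Q 2 \<inter> homogeneous_component h j) = symbolic_power Q 2"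
    (is "ideal_gen ?G = ?N")
proof (rule ideal_gen_bounded_eqI)
  have prime: "is_prime_ideal Q" unfolding Q by (rule is_prime_ideal_curve)
  show "is_ideal ?N" by (rule is_ideal_symbolic_power[OF prime])
  show "homogeneous h ?N"
    using homogeneous_symbolic_power_2[OF prime] homogeneous_curve unfolding Q by blast
  have "(\<Union>j\<in>{..2 * b}. ?N \<inter> homogeneous_component h j) \<subseteq> ?G"
    using B(2) by force
  then have square: "ideal_power Q 2 \<subseteq> ideal_gen ?G"
    using ideal_power_2_bounded_generators[OF gen ideal_power_subset_symbolic_power[OF prime]]
      ideal.span_mono unfolding ideal_gen_def by blast
  show "f \<in> ideal_gen ?G" if "f \<in> ?N" "f \<in> homogeneous_component h (int d)" for f d
    using that
  proof (induction d arbitrary: f rule: less_induct)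
    case (less d)
    show ?case
    proof (cases "int d \<le> B")
      case True
      then show ?thesis
        using less.prems unfolding ideal_gen_def by (intro ideal.span_base) auto
    next
      case False
      let ?x = "Poly_Mapping.single (Poly_Mapping.single i 1) 1 :: ('n, 'k) mpoly"
      have "b + int (h i) + F < int d" using False B by simp
      from symbolic_square_divide_by_variable[OF Q gen large less.prems this F]
      obtain f' where f': "f' \<in> ?N" "f' \<in> homogeneous_component h (int d - int (h i))"
          "f - ?x * f' \<in> ideal_power Q 2"
        by blast
      have "f' \<in> ideal_gen ?G"
      proof (cases "h i \<le> d")
        case True
        then show ?thesis
          using less.IH[of "d - h i" f'] f' pos by (simp add: of_nat_diff)
      next
        case False
        then have "f' = 0" using f'(2) homogeneous_component_negative by force
        then show ?thesis by (simp add: ideal_gen_def ideal.span_zero)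
      qed
      then have "?x * f' + (f - ?x * f') \<in> ideal_gen ?G"
        using f'(3) square unfolding ideal_gen_def
        by (intro ideal.span_add ideal.span_scale) auto
      then show ?thesis by simp
    qed
  qed
qed

section \<open>The Frobenius number\<close>

text \<open>The integers outside of \<open>H\<close> are unbounded below, so the maximum is taken over those from \<open>- 1\<close>
  on: \<open>- 1\<close> itself is never in \<open>H\<close>, hence this part is nonempty, and it is finite.\<close>

lemma frobenius_number_properties:
  assumes "numerical_semigroup H"
  shows "frobenius_number H \<ge> - 1" and "n > frobenius_number H \<Longrightarrow> n \<in> int ` H"
proof -
  let ?P = "\<lambda>b. b \<notin> int ` H"
  obtain N where N: "\<And>n. n \<ge> N \<Longrightarrow> n \<in> H"
    using assms unfolding numerical_semigroup_def by blast
  let ?A = "{b \<in> {- 1..int N}. ?P b}"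
  have minus1: "- 1 \<in> ?A" by auto
  have below: "b \<le> int N" if "?P b" for b
  proof (rule ccontr)
    assume "\<not> b \<le> int N"
    then have "nat b \<in> H" "b = int (nat b)" using N[of "nat b"] by auto
    with that show False by blast
  qed
  have Max: "Max ?A \<in> ?A"
    using minus1 by (intro Max_in finite_subset[of ?A "{- 1..int N}"]) auto
  have max: "b \<le> Max ?A" if "?P b" for b
  proof (cases "b \<ge> - 1")
    case True
    then show ?thesis using that below
      by (intro Max_ge finite_subset[of ?A "{- 1..int N}"]) auto
  next
    case False
    then show ?thesis using Max by simp
  qed
  have eq: "frobenius_number H = Max ?A"
    unfolding frobenius_number_def
    using Max max by (intro Greatest_equality) auto
  show "frobenius_number H \<ge> - 1" using Max unfolding eq by simp
  show "n \<in> int ` H" if "n > frobenius_number H"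
    using max[of n] that unfolding eq by force
qed

lemma generated_submonoid_weighted_degree:
  fixes h :: "'n::finite \<Rightarrow> nat"
  assumes "n \<in> is_submonoid hull (range h)"
  shows "\<exists>m. weighted_degree h m = n"
proof -
  have zero: "weighted_degree h 0 = 0" by (simp add: weighted_degree_def)
  have "is_submonoid hull (range h) \<subseteq> range (weighted_degree h)"
  proof (rule hull_minimal)
    show "range h \<subseteq> range (weighted_degree h)"
      by (metis image_subset_iff rangeI weighted_degree_single)
    show "is_submonoid (range (weighted_degree h))"
      unfolding is_submonoid_def by (force simp flip: weighted_degree_add intro: zero[symmetric])
  qed
  with assms show ?thesis by auto
qed

section \<open>The bound for the symbolic square\<close>

theorem corollary5p2:
  fixes h :: "'n::{finite, linorder} \<Rightarrow> nat"
    and H :: "nat set"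
    and \<pp> :: "('n, 'k::field) mpoly set"
  assumes "infinite (UNIV :: 'k set)"
    and "numerical_semigroup H"
    and "\<And>i. 0 < h i"
    and "strict_mono h"
    and "minimally_generates (range h) H"
    and "\<pp> = vanishing_ideal (monomial_curve h)"
  shows "max_gen_degree h (symbolic_power \<pp> 2)
    \<le> Sup {max_gen_degree h \<pp> + ereal (of_nat (h (Max UNIV))) + ereal (of_int (frobenius_number H)),
           2 * max_gen_degree h \<pp>}"
proof -
  let ?h = "h (Max UNIV)" and ?F = "frobenius_number H"
  let ?gen = "\<lambda>N b. ideal_gen (\<Union>j\<in>{..b}. N \<inter> homogeneous_component h j) = N"
  let ?S = "{b::int. ?gen \<pp> b}"
  define b0 where "b0 = max_gen_degree h \<pp>"
  have b0: "b0 = Inf ((\<lambda>b. ereal (of_int b)) ` ?S)"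
    unfolding b0_def max_gen_degree_def by (rule arg_cong[of _ _ Inf]) blast
  have \<pp>: "\<pp> = {f. curve_poly h f = 0}"
    using assms(1,6) vanishing_ideal_monomial_curve by blast
  have H: "is_submonoid hull (range h) = H"
    using assms(5) by (simp add: minimally_generates_def)
  have large: "\<exists>m. int (weighted_degree h m) = n" if "n > ?F" for n
    using frobenius_number_properties(2)[OF assms(2) that] generated_submonoid_weighted_degree[of _ h]
    unfolding H by auto
  have bound: "max_gen_degree h (symbolic_power \<pp> 2) \<le> ereal (of_int (max (b + int ?h + ?F) (2 * b)))"
    if "b \<in> ?S" for b
  proof -
    have "?gen \<pp> b" using that by simp
    then have "?gen (symbolic_power \<pp> 2) (max (b + int ?h + ?F) (2 * b))"
      by (rule symbolic_square_bounded_generators[OF \<pp> _ large frobenius_number_properties(1)[OF assms(2)]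
            assms(3)[of "Max UNIV"]]) auto
    then show ?thesis
      unfolding max_gen_degree_def by (intro Inf_lower) blast
  qed
  \<comment> \<open>It remains to pass to the infimum over all \<open>b\<close>. It is \<open>\<infinity>\<close>, attained, or \<open>-\<infinity>\<close>.\<close>
  have "max_gen_degree h (symbolic_power \<pp> 2) \<le> max (b0 + ereal (of_nat ?h) + ereal (of_int ?F)) (2 * b0)"
  proof (cases "?S = {}")
    case True
    then show ?thesis unfolding b0 by (simp add: top_ereal_def)
  next
    case nonempty: False
    show ?thesis
    proof (cases "bdd_below ?S")
      case True
      then obtain M where M: "\<And>b. b \<in> ?S \<Longrightarrow> M \<le> b"
        by (auto simp: bdd_below_def)
      \<comment> \<open>A set of integers that is bounded below has a least element: shift it into the naturals.\<close>
      define b where "b = M + int (LEAST n. M + int n \<in> ?S)"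
      obtain b1 where "b1 \<in> ?S" using nonempty by blast
      then have "M + int (nat (b1 - M)) \<in> ?S" using M[of b1] by simp
      then have "b \<in> ?S"
        unfolding b_def by (rule LeastI)
      moreover have "b \<le> c" if "c \<in> ?S" for c
      proof -
        have "M + int (nat (c - M)) \<in> ?S" using M[OF that] that by simp
        then have "(LEAST n. M + int n \<in> ?S) \<le> nat (c - M)" by (rule Least_le)
        then show ?thesis using M[OF that] unfolding b_def by linarith
      qed
      ultimately have "b0 = ereal (of_int b)"
        unfolding b0 by (intro antisym Inf_lower Inf_greatest) auto
      then show ?thesis
        using bound[OF \<open>b \<in> ?S\<close>] by (simp add: max_def split: if_splits)
    next
      case False
      have "max_gen_degree h (symbolic_power \<pp> 2) \<le> ereal r" for r
      proof -
        \<comment> \<open>For \<open>b \<le> 0\<close> the term \<open>2 * b\<close> is at most \<open>b\<close>, so it suffices to bound \<open>b\<close> itself.\<close>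
        obtain b where "b \<in> ?S" and b: "b < min (\<lfloor>r\<rfloor> - int ?h - ?F) (min 0 \<lfloor>r\<rfloor>)"
          using False unfolding bdd_below_def by (meson not_le)
        from b have "max (b + int ?h + ?F) (2 * b) \<le> \<lfloor>r\<rfloor>" by auto
        then have "ereal (of_int (max (b + int ?h + ?F) (2 * b))) \<le> ereal r"
          by (simp only: le_floor_iff ereal_less_eq)
        with bound[OF \<open>b \<in> ?S\<close>] show ?thesis by (rule order_trans)
      qed
      then have "max_gen_degree h (symbolic_power \<pp> 2) = - \<infinity>" by (rule ereal_bot)
      then show ?thesis by simp
    qed
  qed
  then show ?thesis by (simp add: b0_def sup_max)
qed

end
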